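(* Let $d\geq 1$ and $1\leq e_1\leq\cdots\leq e_m$ be integers. Suppose $1\leq a_i\leq e_i$ and $1\leq b_i\leq e_i$, for $i=1,\ldots,m$, are integers such that $d=\sum_{i=1}^m a_i=\sum_{i=1}^m b_i$ and $a=(a_1,\ldots,a_m)\neq b=(b_1,\ldots,b_m)$. Then $$\pi(a,b)\geq \left(\sum_{i=1}^m a_i-\sum_{i=k+1}^m e_i-(k-2)\right)e_{k+1}\cdots e_m-e_{k+2}\cdots e_m$$ for $k=1,\ldots,m-1$, where $e_{k+2}\cdots e_m=1$ when $k=m-1$.
   Context: For sequences of positive integers $a=(a_1,\ldots,a_m)$ and $b=(b_1,\ldots,b_m)$, $\pi(a,b)=\prod_{i=1}^m a_i+\prod_{i=1}^m b_i-\prod_{i=1}^m\min(a_i,b_i)$. *)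

theory Defs
  imports Main
begin

text \<open>
  A sequence \<open>(a\<^sub>1, \<dots>, a\<^sub>m)\<close> of integers is represented by a function on \<open>nat\<close>
  of which only the values at the indices \<open>1, \<dots>, m\<close> are relevant.
\<close>

definition seq_pi :: "nat \<Rightarrow> (nat \<Rightarrow> int) \<Rightarrow> (nat \<Rightarrow> int) \<Rightarrow> int" where
  "seq_pi m a b = (\<Prod>i=1..m. a i) + (\<Prod>i=1..m. b i) - (\<Prod>i=1..m. min (a i) (b i))"

end

theory Submission
  imports Defs "HOL-Combinatorics.Transposition"
begin

text \<open>
  Think of a sequence \<open>a\<close> as the box of lattice points with side lengths \<open>a\<^sub>i\<close>; then
  \<open>\<pi>(a,b)\<close> counts the points in the union of two different boxes with the same sum of
  side lengths. For \<open>1 \<le> R < e\<^sub>k\<close> the extremal pair is \<open>(1,\<dots>,1,R,e\<^sub>k\<^sub>+\<^sub>1,\<dots>,e\<^sub>m)\<close> and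
  \<open>(1,\<dots>,1,R+1,e\<^sub>k\<^sub>+\<^sub>1-1,e\<^sub>k\<^sub>+\<^sub>2,\<dots>,e\<^sub>m)\<close>: as much of the sum as possible sits on the large
  caps. Its two boxes arise from the single box \<open>u = (1,\<dots>,1,R+1,e\<^sub>k\<^sub>+\<^sub>1,\<dots>,e\<^sub>m)\<close> by shortening one
  of two sides by one unit, so their union is the box \<open>u\<close> with a corner notch removed. The
  proof shows that this is typical.

  First, \<open>\<pi>(a,b)\<close> is at least the size of some notched box whose sides sum to \<open>d + 1\<close>, obtained
  from \<open>a\<close> or from \<open>b\<close> by lengthening one side (\<open>prod_pair_ge_notched\<close>). Each of
  the two choices succeeds if one of two opposite inequalities between \<open>a\<close> and \<open>b\<close> holds,
  so one of them always works.

  Second, a full box satisfies \<open>\<Prod>u \<ge> r \<cdot> e\<^sub>k\<^sub>+\<^sub>1 \<cdots> e\<^sub>m\<close>, where the excess \<open>r\<close> is what remains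
  of the sum for coordinate \<open>k\<close> after all higher coordinates are filled up and all lower ones
  are set to 1 (\<open>prod_ge_excess\<close>). For the sum \<open>d + 1\<close> the excess is exactly the first factor
  in the theorem.

  Third, removing the notch lowers this bound by at most \<open>e\<^sub>k\<^sub>+\<^sub>2 \<cdots> e\<^sub>m\<close> (\<open>notched_bound\<close>). Both lower bounds go by
  induction on the number of coordinates: a coordinate that is small compared with \<open>r\<close> and has
  a low cap, or large compared with \<open>r\<close> and has a high cap, can be dropped; if a low cap carries a
  larger value than a high one, the two values can be exchanged. For a notched box the few
  configurations that allow neither are settled by moving one unit between two sides, which
  turns the notched box into a full box that is no larger, or by comparing the notch with the
  whole box.

  The order of the coordinates matters only through the separation into low and high
  caps, hence the lemmas speak of an index set \<open>I\<close> and its subset \<open>H\<close> of high coordinates.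
\<close>

section \<open>The excess over the high caps\<close>

definition excess :: "'a set \<Rightarrow> 'a set \<Rightarrow> ('a \<Rightarrow> int) \<Rightarrow> ('a \<Rightarrow> int) \<Rightarrow> int" where
  "excess I H e u = sum u I - sum e H - (int (card (I - H)) - 1)"

definition capped :: "'a set \<Rightarrow> 'a set \<Rightarrow> ('a \<Rightarrow> int) \<Rightarrow> ('a \<Rightarrow> int) \<Rightarrow> bool" where
  "capped I H e u \<longleftrightarrow> finite I \<and> H \<subseteq> I \<and> (\<forall>l\<in>I - H. \<forall>h\<in>H. e l \<le> e h)
     \<and> (\<forall>i\<in>I. 1 \<le> u i \<and> u i \<le> e i)"

lemma cappedD:
  assumes "capped I H e u"
  shows "finite I" "finite H" "H \<subseteq> I" "\<And>i. i \<in> I \<Longrightarrow> 1 \<le> u i" "\<And>i. i \<in> I \<Longrightarrow> u i \<le> e i"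
    "\<And>l h. l \<in> I - H \<Longrightarrow> h \<in> H \<Longrightarrow> e l \<le> e h"
  using assms by (auto simp: capped_def intro: finite_subset)

lemma prod_caps_pos:
  assumes "capped I H e u" "K \<subseteq> H"
  shows "0 < prod e K"
proof (rule prod_pos)
  fix x assume "x \<in> K"
  then show "0 < e x" using cappedD(3-5)[OF assms(1)] assms(2) by force
qed

lemma capped_remove: "capped I H e u \<Longrightarrow> capped (I - {x}) (H - {x}) e u"
  unfolding capped_def by auto

lemma excess_eq_sums:
  assumes "capped I H e u"
  shows "excess I H e u = 1 + (\<Sum>l\<in>I - H. u l - 1) - (\<Sum>h\<in>H. e h - u h)"
proof -
  have "sum u I = sum u (I - H) + sum u H"
    using cappedD[OF assms] by (metis sum.subset_diff)
  then show ?thesis by (simp add: excess_def sum_subtractf)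
qed

lemma excess_le_low_sum:
  assumes "capped I H e u"
  shows "excess I H e u \<le> 1 + (\<Sum>l\<in>I - H. u l - 1)"
proof -
  have "0 \<le> (\<Sum>h\<in>H. e h - u h)"
    using cappedD[OF assms] by (intro sum_nonneg) auto
  then show ?thesis using excess_eq_sums[OF assms] by simp
qed

lemma excess_remove_low:
  assumes "capped I H e u" "l \<in> I - H"
  shows "excess (I - {l}) (H - {l}) e u = excess I H e u - (u l - 1)"
proof -
  have "sum u I = u l + sum u (I - {l})"
    using cappedD[OF assms(1)] assms(2) by (intro sum.remove) auto
  moreover have "card (I - H) = Suc (card (I - {l} - H))"
    using cappedD[OF assms(1)] assms(2)
    by (metis Diff_insert Diff_insert2 card.remove finite_Diff)
  moreover have "H - {l} = H" using assms(2) by auto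
  ultimately show ?thesis by (simp add: excess_def)
qed

lemma excess_remove_high:
  assumes "capped I H e u" "h \<in> H"
  shows "excess (I - {h}) (H - {h}) e u = excess I H e u + (e h - u h)"
proof -
  have "sum u I = u h + sum u (I - {h})"
    using cappedD[OF assms(1)] assms(2) by (intro sum.remove) auto
  moreover have "sum e H = e h + sum e (H - {h})"
    using cappedD[OF assms(1)] assms(2) by (intro sum.remove) auto
  moreover have "I - {h} - (H - {h}) = I - H" using assms(2) by auto
  ultimately show ?thesis by (simp add: excess_def)
qed

text \<open>
  Exchanging the values of a low and a high coordinate changes neither the excess nor any of
  the products. It is admissible whenever the high coordinate carries the smaller value.
\<close>

lemma transpose_bij:
  assumes "l \<in> I" "h \<in> I"
  shows "bij_betw (transpose l h) I I"
  using assms by (intro bij_betw_byWitness[where f' = "transpose l h"]) (auto simp: transpose_def)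

lemma excess_transpose:
  assumes "l \<in> I" "h \<in> I"
  shows "excess I H e (u \<circ> transpose l h) = excess I H e u"
  using sum.reindex_bij_betw[OF transpose_bij[OF assms], of u] by (simp add: excess_def)

lemma prod_transpose:
  assumes "l \<in> I" "h \<in> I"
  shows "prod (u \<circ> transpose l h) I = prod u I"
  using prod.reindex_bij_betw[OF transpose_bij[OF assms], of u] by simp

lemma prod_transpose_remove:
  assumes "l \<in> I" "h \<in> I" "i \<in> I" "j \<in> I"
  shows "prod (u \<circ> transpose l h) (I - {transpose l h i, transpose l h j}) = prod u (I - {i, j})"
proof -
  have "bij_betw (transpose l h) (I - {transpose l h i, transpose l h j}) (I - {i, j})"
    using assms
    by (intro bij_betw_byWitness[where f' = "transpose l h"]) (auto simp: transpose_def split: if_splits)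
  from prod.reindex_bij_betw[OF this, of u] show ?thesis by simp
qed

lemma capped_transpose:
  assumes "capped I H e u" "l \<in> I - H" "h \<in> H" "u h \<le> u l"
  shows "capped I H e (u \<circ> transpose l h)"
proof -
  have "1 \<le> (u \<circ> transpose l h) i \<and> (u \<circ> transpose l h) i \<le> e i" if "i \<in> I" for i
  proof -
    have I: "l \<in> I" "h \<in> I" using assms(2,3) cappedD(3)[OF assms(1)] by auto
    have "u l \<le> e h"
      using cappedD(5)[OF assms(1) I(1)] cappedD(6)[OF assms(1-3)] by simp
    moreover have "u h \<le> e l" using cappedD(5)[OF assms(1) I(1)] assms(4) by simp
    ultimately show ?thesis
      using that I cappedD(4,5)[OF assms(1)] by (auto simp: transpose_def)
  qed
  then show ?thesis using assms(1) by (auto simp: capped_def)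
qed

section \<open>Lower bound for a single box\<close>

text \<open>
  Write \<open>r\<close> for the excess. Dropping a low coordinate of value \<open>x\<close> lowers the excess by
  \<open>x - 1\<close>, and \<open>x (r - x + 1) \<ge> r\<close> as long as \<open>1 \<le> x \<le> r\<close>. Dropping a high coordinate of value
  \<open>x\<close> and cap \<open>c\<close> raises it by \<open>c - x\<close>, and \<open>x (r + c - x) \<ge> r c\<close> as long as \<open>r \<le> x \<le> c\<close>.
  If no coordinate can be dropped, then every low value exceeds \<open>r\<close> and every high value is
  below \<open>r\<close>; exchanging a low and a high value then creates a high coordinate that can be
  dropped.
\<close>

lemma prod_ge_excess:
  assumes "capped I H e u"
  shows "excess I H e u * prod e H \<le> prod u I"
  using assms
proof (induction "card I" arbitrary: I H u rule: less_induct)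
  case less
  note cap = cappedD[OF less.prems]
  note E_pos = prod_caps_pos[OF less.prems]
  have card: "card (I - {x}) < card I" if "x \<in> I" for x
    using that cap(1) by (rule card_Diff1_less[rotated])
  have low: ?case if l: "l \<in> I - H" and le: "u l \<le> excess I H e u" for l
  proof -
    let ?r = "excess I H e u"
    have Hl: "H - {l} = H" using l by auto
    have "(?r - (u l - 1)) * prod e H \<le> prod u (I - {l})"
      using less.hyps[OF card capped_remove[OF less.prems], of l] l
        excess_remove_low[OF less.prems l] Hl by auto
    then have "u l * ((?r - (u l - 1)) * prod e H) \<le> u l * prod u (I - {l})"
      using cap(4)[of l] l by (intro mult_left_mono) auto
    also have "\<dots> = prod u I" using l cap(1) by (subst prod.remove[of I l]) auto
    finally have 1: "u l * (?r - (u l - 1)) * prod e H \<le> prod u I" by (simp add: mult.assoc)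
    have "0 \<le> (u l - 1) * (?r - u l)" using le cap(4)[of l] l by (intro mult_nonneg_nonneg) auto
    then have "?r \<le> u l * (?r - (u l - 1))" by (simp add: algebra_simps)
    then have "?r * prod e H \<le> u l * (?r - (u l - 1)) * prod e H"
      using E_pos[of H] by (intro mult_right_mono) auto
    with 1 show ?thesis by linarith
  qed
  have high: "excess I H e v * prod e H \<le> prod v I"
    if v: "capped I H e v" and h: "h \<in> H" and ge: "excess I H e v \<le> v h" for v h
  proof -
    let ?r = "excess I H e v"
    have hI: "h \<in> I" using h cap(3) by auto
    have "(?r + (e h - v h)) * prod e (H - {h}) \<le> prod v (I - {h})"
      using less.hyps[OF card[OF hI] capped_remove[OF v]] excess_remove_high[OF v h] by auto
    then have "v h * ((?r + (e h - v h)) * prod e (H - {h})) \<le> v h * prod v (I - {h})"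
      using cappedD(4)[OF v hI] by (intro mult_left_mono) auto
    also have "\<dots> = prod v I" using hI cap(1) by (subst prod.remove[of I h]) auto
    finally have 1: "v h * (?r + (e h - v h)) * prod e (H - {h}) \<le> prod v I"
      by (simp add: mult.assoc)
    have "0 \<le> (e h - v h) * (v h - ?r)"
      using ge cappedD(5)[OF v hI] by (intro mult_nonneg_nonneg) auto
    then have "?r * e h \<le> v h * (?r + (e h - v h))" by (simp add: algebra_simps)
    then have "?r * e h * prod e (H - {h}) \<le> v h * (?r + (e h - v h)) * prod e (H - {h})"
      using E_pos[of "H - {h}"] by (intro mult_right_mono) auto
    moreover have "prod e H = e h * prod e (H - {h})"
      using h cap(2) by (intro prod.remove) auto
    ultimately show ?thesis using 1 by (simp add: mult.assoc)
  qed
  show ?case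
  proof (cases "(\<exists>l\<in>I - H. u l \<le> excess I H e u) \<or> (\<exists>h\<in>H. excess I H e u \<le> u h)")
    case True
    then show ?thesis using low high[OF less.prems] by blast
  next
    case False
    then have L: "\<And>l. l \<in> I - H \<Longrightarrow> excess I H e u < u l"
      and Hi: "\<And>h. h \<in> H \<Longrightarrow> u h < excess I H e u" by force+
    show ?thesis
    proof (cases "I - H = {} \<or> H = {}")
      case False
      then obtain l h where lh: "l \<in> I - H" "h \<in> H" by auto
      then have "l \<in> I" "h \<in> I" using cap(3) by auto
      note tr = excess_transpose[OF this, of H e u] prod_transpose[OF this, of u]
      have "u h \<le> u l" using L[OF lh(1)] Hi[OF lh(2)] by linarith
      from high[OF capped_transpose[OF less.prems lh this] lh(2)] tr L[OF lh(1)]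
      show ?thesis by simp
    next
      case deg: True
      \<comment> \<open>With only high coordinates the excess is at most 1, with only low ones it is at least
        every single value; so some coordinate could have been dropped.\<close>
      have "I = {}"
      proof (rule ccontr)
        assume "I \<noteq> {}"
        show False
        proof (cases "I - H = {}")
          case True
          then obtain h where h: "h \<in> H" using \<open>I \<noteq> {}\<close> by auto
          have "excess I H e u \<le> 1" using excess_le_low_sum[OF less.prems] unfolding True by simp
          with Hi[OF h] cap(3,4) h show False by force
        next
          case ne: False
          then have H0: "H = {}" using deg by auto
          from ne obtain l where l: "l \<in> I - H" by auto
          have "u l - 1 \<le> (\<Sum>l\<in>I - H. u l - 1)"
            using cap(1,4) l by (intro member_le_sum) (auto simp: int_one_le_iff_zero_less)
          then have "u l \<le> excess I H e u"
            using excess_eq_sums[OF less.prems] H0 by simp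
          with L[OF l] show False by simp
        qed
      qed
      then show ?thesis using cap(3) by (simp add: excess_def)
    qed
  qed
qed

section \<open>Lower bound for a notched box\<close>

text \<open>
  The box \<open>u\<close> minus its corner notch of thickness 1 in the directions \<open>i\<close> and \<open>j\<close> has
  \<open>\<Prod>u - \<Prod>\<^bsub>l \<notin> {i,j}\<^esub> u\<^sub>l\<close> points; it is the union of the two boxes obtained by shortening side
  \<open>i\<close> or side \<open>j\<close> by one. The inequality is that this number is at least
  \<open>r \<Prod>e - (\<Prod>e) / s\<close>, multiplied by \<open>s\<close>. Letting \<open>s\<close> be any lower bound of the high caps,
  instead of their minimum, keeps it fixed when a coordinate is dropped, and makes sense for
  empty \<open>H\<close>.
\<close>

definition notched_bound ::
  "'a set \<Rightarrow> 'a set \<Rightarrow> ('a \<Rightarrow> int) \<Rightarrow> int \<Rightarrow> ('a \<Rightarrow> int) \<Rightarrow> 'a \<Rightarrow> 'a \<Rightarrow> bool" where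
  "notched_bound I H e s u i j \<longleftrightarrow>
     s * (excess I H e u * prod e H) \<le> s * (prod u I - prod u (I - {i, j})) + prod e H"

lemma notched_bound_commute: "notched_bound I H e s u i j = notched_bound I H e s u j i"
  by (simp add: notched_bound_def insert_commute)

lemma notched_bound_transpose:
  assumes "l \<in> I" "h \<in> I" "i \<in> I" "j \<in> I"
    and "notched_bound I H e s (u \<circ> transpose l h) (transpose l h i) (transpose l h j)"
  shows "notched_bound I H e s u i j"
  using assms(5)
  unfolding notched_bound_def excess_transpose[OF assms(1,2)] prod_transpose[OF assms(1,2)]
    prod_transpose_remove[OF assms(1-4)] .

lemma prod_remove_marks:
  assumes "finite I" "i \<in> I" "j \<in> I" "i \<noteq> j"
  shows "prod u I = u i * u j * prod u (I - {i, j})"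
proof -
  have "prod u I = u i * (u j * prod u (I - {i} - {j}))"
    using assms by (subst prod.remove[of I i]; simp add: prod.remove[of "I - {i}" j])
  then show ?thesis by (simp add: Diff_insert2[symmetric] mult.assoc insert_commute)
qed

text \<open>
  The computation of \<open>prod_ge_excess\<close> with the extra term \<open>(\<Prod>e) / s\<close>, which is multiplied by
  \<open>x = u\<^sub>l\<close> when the coordinate is put back. For \<open>x > 1\<close> this has to be paid for by the gain
  \<open>(x - 1) (r - x) \<Prod>e\<close>, hence the strict inequality \<open>x < r\<close>.
\<close>

lemma notched_bound_remove_low:
  assumes cap: "capped I H e u" and l: "l \<in> I - H" "l \<notin> {i, j}" and s: "1 \<le> s"
    and small: "u l = 1 \<or> u l < excess I H e u"
    and IH: "notched_bound (I - {l}) (H - {l}) e s u i j"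
  shows "notched_bound I H e s u i j"
proof -
  define r x E F where "r = excess I H e u" and "x = u l" and "E = prod e H"
    and "F = prod u (I - {l}) - prod u (I - {l} - {i, j})"
  have Hl: "H - {l} = H" using l by auto
  have x: "1 \<le> x" using cappedD(4)[OF cap, of l] l by (auto simp: x_def)
  have E: "0 < E" using prod_caps_pos[OF cap order_refl] by (simp add: E_def)
  have IH': "s * ((r - (x - 1)) * E) \<le> s * F + E"
    using IH excess_remove_low[OF cap l(1)]
    by (simp add: notched_bound_def Hl r_def x_def E_def F_def)
  have F: "prod u I - prod u (I - {i, j}) = x * F"
  proof -
    have "prod u I = x * prod u (I - {l})" unfolding x_def
      using l cappedD(1)[OF cap] by (intro prod.remove) auto
    moreover have "prod u (I - {i, j}) = x * prod u (I - {i, j} - {l})" unfolding x_def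
      using l cappedD(1)[OF cap] by (intro prod.remove) auto
    moreover have "I - {i, j} - {l} = I - {l} - {i, j}" by auto
    ultimately show ?thesis by (simp add: F_def algebra_simps)
  qed
  have "0 \<le> (x - 1) * (s * (r - x) - 1) * E"
  proof (cases "x = 1")
    case False
    then have "1 \<le> r - x" using small by (auto simp: r_def x_def)
    then have "1 * 1 \<le> s * (r - x)" using s by (intro mult_mono) auto
    then show ?thesis using x E by auto
  qed simp
  moreover have "x * (s * ((r - (x - 1)) * E)) \<le> x * (s * F + E)"
    using IH' x by (intro mult_left_mono) auto
  ultimately have "s * (r * E) \<le> s * (x * F) + E" by (simp add: algebra_simps)
  then show ?thesis unfolding notched_bound_def F by (simp add: r_def E_def)
qed

text \<open>
  Here the extra term only helps: it is multiplied by \<open>u\<^sub>h\<close> when the coordinate is put back,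
  whereas the product of the caps is multiplied by \<open>e\<^sub>h \<ge> u\<^sub>h\<close>.
\<close>

lemma notched_bound_remove_high:
  assumes cap: "capped I H e u" and h: "h \<in> H" "h \<notin> {i, j}" and s: "1 \<le> s"
    and large: "excess I H e u \<le> u h \<or> u h = e h"
    and IH: "notched_bound (I - {h}) (H - {h}) e s u i j"
  shows "notched_bound I H e s u i j"
proof -
  define r x E F where "r = excess I H e u" and "x = u h" and "E = prod e (H - {h})"
    and "F = prod u (I - {h}) - prod u (I - {h} - {i, j})"
  have hI: "h \<in> I" using h cappedD(3)[OF cap] by auto
  have x: "1 \<le> x" "x \<le> e h" using cappedD(4,5)[OF cap hI] by (auto simp: x_def)
  have E: "0 < E" using prod_caps_pos[OF cap, of "H - {h}"] by (auto simp: E_def)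
  have EH: "prod e H = e h * E" unfolding E_def
    using h cappedD(2)[OF cap] by (intro prod.remove) auto
  have IH': "s * ((r + (e h - x)) * E) \<le> s * F + E"
    using IH excess_remove_high[OF cap h(1)]
    by (simp add: notched_bound_def r_def x_def E_def F_def)
  have F: "prod u I - prod u (I - {i, j}) = x * F"
  proof -
    have "prod u I = x * prod u (I - {h})" unfolding x_def
      using hI cappedD(1)[OF cap] by (intro prod.remove) auto
    moreover have "prod u (I - {i, j}) = x * prod u (I - {i, j} - {h})" unfolding x_def
      using h(2) hI cappedD(1)[OF cap] by (intro prod.remove) auto
    moreover have "I - {i, j} - {h} = I - {h} - {i, j}" by auto
    ultimately show ?thesis by (simp add: F_def algebra_simps)
  qed
  have "0 \<le> (e h - x) * (x - r)"
  proof (cases "x = e h")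
    case False
    then show ?thesis using large x by (simp add: r_def x_def)
  qed simp
  then have "0 \<le> s * ((e h - x) * (x - r)) * E + (e h - x) * E" using s x E by simp
  moreover have "x * (s * ((r + (e h - x)) * E)) \<le> x * (s * F + E)"
    using IH' x by (intro mult_left_mono) auto
  ultimately have "s * (r * (e h * E)) \<le> s * (x * F) + e h * E" by (simp add: algebra_simps)
  then show ?thesis unfolding notched_bound_def F EH by (simp add: r_def)
qed

lemma notched_bound_of_excess_le:
  assumes "capped I H e u" "0 \<le> s"
    and "excess I H e u * prod e H \<le> prod u I - prod u (I - {i, j})"
  shows "notched_bound I H e s u i j"
  unfolding notched_bound_def
  using mult_left_mono[OF assms(3,2)] prod_caps_pos[OF assms(1) order_refl] by linarith

text \<open>
  The notch takes the fraction \<open>1 / (u\<^sub>i u\<^sub>j)\<close> of the box, so the bound \<open>s r \<Prod>e\<close> for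
  \<open>s\<close> full boxes loses \<open>s r (\<Prod>e) / (u\<^sub>i u\<^sub>j) \<le> \<Prod>e\<close>.
\<close>

lemma notched_bound_of_large_marks:
  assumes cap: "capped I H e u" and ij: "i \<in> I" "j \<in> I" "i \<noteq> j"
    and s: "0 \<le> s" and large: "s * excess I H e u \<le> u i * u j"
  shows "notched_bound I H e s u i j"
proof -
  define P W r E where "P = u i * u j" and "W = prod u (I - {i, j})"
    and "r = excess I H e u" and "E = prod e H"
  have U: "prod u I = P * W"
    using prod_remove_marks[OF cappedD(1)[OF cap] ij] by (simp add: P_def W_def)
  have "1 * 1 \<le> P" unfolding P_def using cappedD(4)[OF cap] ij by (intro mult_mono) force+
  then have P: "1 \<le> P" by simp
  have E: "0 < E" using prod_caps_pos[OF cap order_refl] by (simp add: E_def)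
  have "r * E \<le> P * W" using prod_ge_excess[OF cap] by (simp add: U r_def E_def)
  then have "s * (P - 1) * (r * E) \<le> s * (P - 1) * (P * W)"
    using s P by (intro mult_left_mono) auto
  moreover have "s * r * E \<le> P * E"
    using large E by (intro mult_right_mono) (auto simp: r_def P_def)
  ultimately have "P * (s * (r * E)) \<le> P * (s * (P * W - W) + E)" by (simp add: algebra_simps)
  then have "s * (r * E) \<le> s * (P * W - W) + E" using P by simp
  then show ?thesis by (simp add: notched_bound_def U W_def r_def E_def)
qed

text \<open>
  Moving a unit from the smaller marked side \<open>p\<close> to the larger one \<open>q\<close> gives
  \<open>(p - 1) (q + 1) \<le> p q - 1\<close>, so the resulting full box is no larger than the notched one, and
  the bound for full boxes applies without loss. Only the two values matter, so the larger one
  may end up at either marked coordinate, \<open>j'\<close>, whichever has the room for it.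
\<close>

lemma excess_le_of_transfer:
  assumes cap: "capped I H e u" and ij: "i \<in> I" "j \<in> I" "i \<noteq> j"
    and le: "2 \<le> u i" "u i \<le> u j" and j': "{i', j'} = {i, j}"
    and e: "u i \<le> e i' + 1" "u j < e j'"
  shows "excess I H e u * prod e H \<le> prod u I - prod u (I - {i, j})"
proof -
  define v where "v = u(i' := u i - 1, j' := u j + 1)"
  have ne: "i' \<noteq> j'" using ij j' by auto
  note c = cappedD[OF cap]
  have cv: "capped I H e v"
    using cap le e ne by (auto simp: capped_def v_def)
  have out: "prod v (I - {i, j}) = prod u (I - {i, j})" 
    using j' by (intro prod.cong) (auto simp: v_def)
  have outs: "sum v (I - {i, j}) = sum u (I - {i, j})" 
    using j' by (intro sum.cong) (auto simp: v_def)
  have pv: "v i * v j = (u i - 1) * (u j + 1)" "v i + v j = u i + u j"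
    using j' ne ij(3) by (auto simp: v_def doubleton_eq_iff)
  have sp: "sum w I = w i + w j + sum w (I - {i, j})" for w
    using sum.subset_diff[of "{i, j}" I w] ij c(1) by (simp add: add.commute)
  have ex: "excess I H e v = excess I H e u"
    using sp[of u] sp[of v] outs pv(2) by (simp add: excess_def)
  have "0 < prod u (I - {i, j})" using c(4) by (intro prod_pos) force
  have "(u i - 1) * (u j + 1) \<le> u i * u j - 1" using le by (simp add: algebra_simps)
  then have "prod v I \<le> (u i * u j - 1) * prod u (I - {i, j})"
    using \<open>0 < _\<close> pv out prod_remove_marks[OF c(1) ij, of v] by (simp add: mult_right_mono)
  also have "\<dots> = prod u I - prod u (I - {i, j})"
    using prod_remove_marks[OF c(1) ij, of u] by (simp add: algebra_simps)
  finally show ?thesis using prod_ge_excess[OF cv] ex by simp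
qed

text \<open>
  The same with the unit moved to a third side that is longer than both marked ones: with
  \<open>p \<le> q < x\<close> one has \<open>(p - 1) q (x + 1) \<le> (p q - 1) x\<close>, since \<open>q (p - 1) \<le> x (q - 1)\<close>.
\<close>

lemma excess_le_of_outer_transfer:
  assumes cap: "capped I H e u" and ij: "i \<in> I" "j \<in> I" "i \<noteq> j" and h: "h \<in> I - {i, j}"
    and le: "2 \<le> u i" "u i \<le> u j" "u j < u h" "u h < e h"
  shows "excess I H e u * prod e H \<le> prod u I - prod u (I - {i, j})"
proof -
  define v where "v = u(i := u i - 1, h := u h + 1)"
  define R where "R = I - {i, j} - {h}"
  note c = cappedD[OF cap]
  have cv: "capped I H e v"
    using cap le h by (auto simp: capped_def v_def)
  have pv: "prod w (I - {i, j}) = w h * prod w R" for w :: "'a \<Rightarrow> int"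
    unfolding R_def using h c(1) by (intro prod.remove) auto
  have sv: "sum w (I - {i, j}) = w h + sum w R" for w :: "'a \<Rightarrow> int"
    unfolding R_def using h c(1) by (intro sum.remove) auto
  have sp: "sum w I = w i + w j + sum w (I - {i, j})" for w :: "'a \<Rightarrow> int"
    using sum.subset_diff[of "{i, j}" I w] ij c(1) by (simp add: add.commute)
  have R: "prod v R = prod u R" "sum v R = sum u R"
    by (auto simp: R_def v_def intro!: prod.cong sum.cong)
  have ex: "excess I H e v = excess I H e u"
    using sp[of u] sp[of v] sv[of u] sv[of v] R h ij by (auto simp: excess_def v_def)
  have pos: "0 < prod u R" using c(4) by (intro prod_pos) (force simp: R_def)
  have "u j * (u i - 1) \<le> u j * (u j - 1)" using le by (intro mult_left_mono) auto
  also have "\<dots> \<le> u h * (u j - 1)" using le by (intro mult_right_mono) auto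
  finally have "(u i - 1) * u j * (u h + 1) \<le> (u i * u j - 1) * u h"
    by (simp add: algebra_simps)
  then have "(u i - 1) * u j * (u h + 1) * prod u R \<le> (u i * u j - 1) * u h * prod u R"
    using pos by (intro mult_right_mono) auto
  moreover have "prod v I = (u i - 1) * u j * (u h + 1) * prod u R"
    using prod_remove_marks[OF c(1) ij, of v] pv[of v] R h ij by (auto simp: v_def)
  moreover have "(u i * u j - 1) * u h * prod u R = prod u I - prod u (I - {i, j})"
    using prod_remove_marks[OF c(1) ij, of u] pv[of u] by (simp add: algebra_simps)
  ultimately show ?thesis using prod_ge_excess[OF cv] ex by simp
qed

text \<open>
  Induction on the number of coordinates, where the excess \<open>r\<close> may be taken positive. When values
  are exchanged, a mark moves along with its value. By symmetry let \<open>u\<^sub>i \<le> u\<^sub>j\<close>; unless the transfer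
  within the marked sides settles the claim, the larger marked side is full, \<open>u\<^sub>j = e\<^sub>j\<close>.

  If there is an unmarked high coordinate \<open>h\<close> that cannot be dropped, then \<open>u\<^sub>h < r\<close> and
  \<open>u\<^sub>h < e\<^sub>h\<close>. A low coordinate with a value of at least \<open>u\<^sub>h\<close> can take over the value \<open>u\<^sub>h\<close>
  and be dropped. Otherwise every low value is below \<open>u\<^sub>h < r\<close>, so unmarked low coordinates
  can be dropped, and if there are none, a single marked low coordinate could not produce the excess
  \<open>r\<close>; so both marked coordinates are low and a unit can be moved to \<open>h\<close>.

  If all high coordinates are marked, then all unmarked ones are low and, unless one can
  be dropped, at least \<open>max 2 r\<close>. When \<open>i\<close> is high, the unmarked values may also be taken to be
  below \<open>u\<^sub>i\<close>, by exchange. Then \<open>u\<^sub>i \<ge> r\<close> and \<open>u\<^sub>j \<ge> s\<close>, so that the notch is small, unless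
  \<open>j\<close> is low and \<open>u\<^sub>j < e\<^sub>i\<close>; in that case the transfer works with the larger side put at \<open>i\<close>.
  When \<open>i\<close> is low, a further low value \<open>w\<close> would give \<open>r \<ge> w + u\<^sub>i - 1 > w\<close>; so only the
  marked coordinates are left, with \<open>r = u\<^sub>i\<close> if \<open>j\<close> is high and \<open>r = u\<^sub>i + u\<^sub>j - 1\<close> if not.
\<close>

lemma notched_bound:
  assumes "capped I H e u" "i \<in> I" "j \<in> I" "i \<noteq> j" "2 \<le> u i" "2 \<le> u j"
    and s: "1 \<le> s" "\<And>h. h \<in> H \<Longrightarrow> s \<le> e h"
  shows "notched_bound I H e s u i j"
  using assms
proof (induction "card I" arbitrary: I H u i j rule: less_induct)
  case less
  have step: "notched_bound I H e s u i j"
    if cap: "capped I H e u" and ij: "i \<in> I" "j \<in> I" "i \<noteq> j"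
      and two: "2 \<le> u i" and le: "u i \<le> u j" for u i j
  proof -
    let ?r = "excess I H e u"
    note c = cappedD[OF cap]
    have twoj: "2 \<le> u j" using two le by simp
    have s0: "0 \<le> s" using less.prems by simp
    have IH: "notched_bound (I - {x}) (H - {x}) e s v a b"
      if "capped I H e v" "x \<in> I" "a \<in> I - {x}" "b \<in> I - {x}" "a \<noteq> b" "2 \<le> v a" "2 \<le> v b" for v x a b
      using less.hyps[OF card_Diff1_less[OF c(1) that(2)] capped_remove[OF that(1)] that(3-7)]
        less.prems(7,8) by blast
    have low: "notched_bound I H e s v a b"
      if "capped I H e v" "l \<in> I - H" "l \<notin> {a, b}" "v l = 1 \<or> v l < excess I H e v"
        "a \<in> I" "b \<in> I" "a \<noteq> b" "2 \<le> v a" "2 \<le> v b" for v l a b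
      using that less.prems(7) by (intro notched_bound_remove_low[of I H e v l] IH) auto
    have high: "notched_bound I H e s v a b"
      if "capped I H e v" "h \<in> H" "h \<notin> {a, b}" "excess I H e v \<le> v h \<or> v h = e h"
        "a \<in> I" "b \<in> I" "a \<noteq> b" "2 \<le> v a" "2 \<le> v b" for v h a b
      using that less.prems(7) c(3) by (intro notched_bound_remove_high[of I H e v h] IH) auto
    have swap: "notched_bound I H e s u i j"
      if lh: "l \<in> I - H" "h \<in> H" "u h \<le> u l"
        and x: "h \<notin> {i, j} \<and> u h < ?r \<or> l \<notin> {i, j} \<and> ?r \<le> u l" for l h
    proof -
      let ?t = "transpose l h"
      have I: "l \<in> I" "h \<in> I" using lh c(3) by auto
      have ct: "capped I H e (u \<circ> ?t)" by (rule capped_transpose[OF cap lh])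
      have tI: "?t i \<in> I" "?t j \<in> I" "?t i \<noteq> ?t j"
        using ij I by (auto simp: transpose_def)
      have t2: "2 \<le> (u \<circ> ?t) (?t i)" "2 \<le> (u \<circ> ?t) (?t j)" using two twoj by auto
      have ex: "excess I H e (u \<circ> ?t) = ?r" by (rule excess_transpose[OF I])
      have "notched_bound I H e s (u \<circ> ?t) (?t i) (?t j)"
        using x
      proof
        assume "h \<notin> {i, j} \<and> u h < ?r"
        then have "l \<notin> {?t i, ?t j}" "(u \<circ> ?t) l < excess I H e (u \<circ> ?t)"
          unfolding ex by (auto simp: transpose_def split: if_splits)
        then show ?thesis using low[OF ct lh(1) _ _ tI t2] by blast
      next
        assume "l \<notin> {i, j} \<and> ?r \<le> u l"
        then have "h \<notin> {?t i, ?t j}" "excess I H e (u \<circ> ?t) \<le> (u \<circ> ?t) h"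
          unfolding ex by (auto simp: transpose_def split: if_splits)
        then show ?thesis using high[OF ct lh(2) _ _ tI t2] by blast
      qed
      then show ?thesis by (rule notched_bound_transpose[OF I ij(1,2)])
    qed
    note easy = notched_bound_of_excess_le[OF cap s0]
    note big = notched_bound_of_large_marks[OF cap ij s0]
    have low_u: ?thesis if "l \<in> I - H" "l \<notin> {i, j}" "u l = 1 \<or> u l < ?r" for l
      using low[OF cap that ij two twoj] .
    consider (nonpos) "?r \<le> 0" | (notfull) "u j < e j"
      | (outer) h where "0 < ?r" "h \<in> H - {i, j}"
      | (marked) "0 < ?r" "u j = e j" "H \<subseteq> {i, j}"
      using c(5)[OF ij(2)] by fastforce
    then show ?thesis
    proof cases
      case nonpos
      have "0 < prod u (I - {i, j})" using c(4) by (intro prod_pos) force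
      moreover have "1 * 1 \<le> u i * u j" using two le by (intro mult_mono) auto
      ultimately have "prod u (I - {i, j}) \<le> prod u I"
        using prod_remove_marks[OF c(1) ij, of u] by simp
      moreover have "?r * prod e H \<le> 0"
        using nonpos prod_caps_pos[OF cap order_refl] by (simp add: mult_nonpos_nonneg)
      ultimately show ?thesis by (intro easy) simp
    next
      case notfull
      show ?thesis
        using c(5)[OF ij(1)] notfull
        by (intro easy excess_le_of_transfer[OF cap ij two le, of i j]) auto
    next
      case outer
      then have hI: "h \<in> H" "h \<in> I" "h \<notin> {i, j}" using c(3) by auto
      show ?thesis
      proof (cases "?r \<le> u h \<or> u h = e h")
        case True
        then show ?thesis using high[OF cap hI(1,3) _ ij two twoj] by blast
      next
        case False
        then have h: "u h < ?r" "u h < e h" using c(5)[OF hI(2)] by auto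
        show ?thesis
        proof (cases "\<exists>l\<in>I - H. u h \<le> u l \<or> l \<notin> {i, j}")
          case True
          then obtain l where l: "l \<in> I - H" "u h \<le> u l \<or> l \<notin> {i, j}" by blast
          show ?thesis
          proof (cases "u h \<le> u l")
            case True
            then show ?thesis using swap[OF l(1) hI(1)] h hI by blast
          next
            case False
            then show ?thesis using low_u[OF l(1)] l h by auto
          qed
        next
          case False
          then have L: "I - H \<subseteq> {i, j}" "\<And>l. l \<in> I - H \<Longrightarrow> u l < u h" by (auto simp: not_le)
          have rr: "?r \<le> 1 + (\<Sum>l\<in>I - H. u l - 1)" by (rule excess_le_low_sum[OF cap])
          have "I - H \<noteq> {}"
          proof
            assume "I - H = {}"
            then have "?r \<le> 1" using rr by (simp only: sum.empty)
            then show False using h c(4)[OF hI(2)] by simp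
          qed
          moreover have "I - H \<noteq> {x}" for x
          proof
            assume x: "I - H = {x}"
            then have "?r \<le> u x" using rr by simp
            then show False using L(2)[of x] x h by simp
          qed
          ultimately have "j \<in> I - H"
            using L(1) by (metis insert_commute subset_insert subset_singletonD)
          then have "u j < u h" using L(2) by auto
          then show ?thesis
            using excess_le_of_outer_transfer[OF cap ij _ two le _ h(2)] hI by (intro easy) auto
        qed
      qed
    next
      case marked
      show ?thesis
      proof (cases "\<exists>l\<in>I - H - {i, j}. u l = 1 \<or> u l < ?r")
        case True
        then show ?thesis using low_u by blast
      next
        case False
        then have un: "\<And>w. w \<in> I - {i, j} \<Longrightarrow> w \<in> I - H \<and> 2 \<le> u w \<and> ?r \<le> u w"
          using marked(3) c(4) by force
        show ?thesis
        proof (cases "i \<in> H")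
          case iH: True
          show ?thesis
          proof (cases "\<exists>w\<in>I - {i, j}. u i \<le> u w")
            case True
            then show ?thesis using swap[OF _ iH] un by blast
          next
            case below: False
            show ?thesis
            proof (cases "j \<notin> H \<and> u j < e i")
              case True
              then show ?thesis
                using c(5)[OF ij(2)] le
                by (intro easy excess_le_of_transfer[OF cap ij two le, of j i]) auto
            next
              case False
              have jH: "j \<in> H \<or> u j = e i"
                using False c(6)[of j i] iH ij(2) marked(2) by fastforce
              have su: "s \<le> u j"
                using jH less.prems(8) iH marked(2) by auto
              have "?r \<le> u i"
              proof (cases "I - {i, j} = {}")
                case True
                then have I: "I = {i, j}" using ij by auto
                show ?thesis
                proof (cases "j \<in> H")
                  case True
                  then have "I - H = {}" using I iH by auto
                  then have "?r \<le> 1" using excess_le_low_sum[OF cap] by (simp only: sum.empty)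
                  then show ?thesis using two by simp
                next
                  case False
                  then have "I - H = {j}" "H = {i}" using I iH ij(3) marked(3) by auto
                  then show ?thesis using excess_eq_sums[OF cap] False jH by simp
                qed
              next
                case False
                then obtain w where "w \<in> I - {i, j}" by blast
                then have "?r \<le> u w" "u w < u i" using un[of w] below by (auto simp: not_le)
                then show ?thesis by simp
              qed
              then have "s * ?r \<le> u j * u i"
                using su marked(1) twoj by (intro mult_mono) auto
              then show ?thesis by (intro big) (simp add: mult.commute)
            qed
          qed
        next
          case iL: False
          have "(\<Sum>h\<in>H. e h - u h) = 0"
            using marked(2,3) iL by (intro sum.neutral) auto
          then have r: "?r = 1 + (\<Sum>l\<in>I - H. u l - 1)"
            using excess_eq_sums[OF cap] by simp
          have "I - {i, j} = {}"
          proof (rule ccontr)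
            assume "I - {i, j} \<noteq> {}"
            then obtain w where w: "w \<in> I - {i, j}" by blast
            have "(\<Sum>l\<in>{i, w}. u l - 1) \<le> (\<Sum>l\<in>I - H. u l - 1)"
              using un[OF w] w iL ij c(1,4) by (intro sum_mono2) (auto simp: int_one_le_iff_zero_less)
            moreover have "i \<noteq> w" using w by auto
            ultimately show False using r un[OF w] two by simp
          qed
          then have I: "I = {i, j}" using ij by auto
          show ?thesis
          proof (cases "j \<in> H")
            case True
            then have "I - H = {i}" using I iL by auto
            then have "?r = u i" using r by simp
            moreover have "s \<le> u j" using less.prems(8) True marked(2) by auto
            ultimately show ?thesis using two by (intro big) (simp add: mult.commute)
          next
            case False
            then have H: "H = {}" using iL marked(3) by auto
            then have "?r = u i + u j - 1" using r I ij(3) by simp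
            moreover have "1 * 1 \<le> (u i - 1) * (u j - 1)"
              using two twoj by (intro mult_mono) auto
            ultimately have "?r \<le> u i * u j - 1" by (simp add: algebra_simps)
            then show ?thesis using I H ij(3) by (intro easy) simp
          qed
        qed
      qed
    qed
  qed
  show ?case
  proof (cases "u i \<le> u j")
    case True
    then show ?thesis using step less.prems by blast
  next
    case False
    then show ?thesis using step[of u j i] less.prems notched_bound_commute[of I H e s u i j] by auto
  qed
qed

section \<open>From pairs of boxes to notched boxes\<close>

text \<open>
  The inequality \<open>\<Prod>(1 + z\<^sub>l) \<ge> 1 + \<Sum>z\<^sub>l\<close> for \<open>z\<^sub>l = (b\<^sub>l - c\<^sub>l) / c\<^sub>l \<ge> (b\<^sub>l - c\<^sub>l) / \<alpha>\<close>, with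
  denominators cleared.
\<close>

lemma prod_diff_ge_sum_diff:
  fixes b c :: "'a \<Rightarrow> int"
  assumes "finite S" "\<And>l. l \<in> S \<Longrightarrow> 1 \<le> c l \<and> c l \<le> b l" "0 \<le> \<alpha>"
    "\<And>l. l \<in> S \<Longrightarrow> c l < b l \<Longrightarrow> c l \<le> \<alpha>"
  shows "(\<Sum>l\<in>S. b l - c l) * prod c S \<le> \<alpha> * (prod b S - prod c S)"
  using assms
proof (induction S)
  case (insert x S)
  define B C T where "B = prod b S" and "C = prod c S" and "T = (\<Sum>l\<in>S. b l - c l)"
  have IH: "T * C \<le> \<alpha> * (B - C)" using insert unfolding B_def C_def T_def by auto
  have C: "0 < C" unfolding C_def using insert.prems by (intro prod_pos) force
  have T: "0 \<le> T" unfolding T_def using insert.prems by (intro sum_nonneg) auto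
  have x: "1 \<le> c x" "c x \<le> b x" using insert.prems by auto
  have 1: "(b x - c x) * c x \<le> (b x - c x) * \<alpha>"
    using insert.prems(3)[of x] x by (cases "c x < b x") (auto intro: mult_left_mono)
  have "(T + (b x - c x)) * (c x * C) \<le> b x * (T * C) + (b x - c x) * c x * C"
    using mult_right_mono[OF x(2), of "T * C"] T C by (simp add: algebra_simps)
  also have "\<dots> \<le> b x * (\<alpha> * (B - C)) + (b x - c x) * \<alpha> * C"
    using x C by (intro add_mono[OF mult_left_mono[OF IH] mult_right_mono[OF 1]]) auto
  also have "\<dots> = \<alpha> * (b x * B - c x * C)" by (simp add: algebra_simps)
  finally show ?case using insert.hyps by (simp add: B_def C_def T_def add.commute)
qed simp

text \<open>
  Let \<open>A\<close>, \<open>B\<close>, \<open>C\<close> be the products of \<open>a\<close>, \<open>b\<close> and their minimum, \<open>\<alpha> = a\<^sub>j\<close>, \<open>\<beta> = b\<^sub>i\<close>,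
  and let \<open>t\<close> be the sum of \<open>a - min a b\<close>. The notched box \<open>u\<close> has \<open>A + (A / \<alpha>) (1 - 1 / a\<^sub>i)\<close>
  points, so the claim is \<open>\<alpha> (B - C) \<ge> A (1 - 1 / a\<^sub>i)\<close>. As \<open>a\<^sub>i \<le> \<beta> + t\<close>, the right-hand side is at most
  \<open>A (1 - 1 / (\<beta> + t))\<close>; and with \<open>Z = \<beta> (A - C)\<close>, that is \<open>A = C + Z / \<beta>\<close>, this is at most
  \<open>Z\<close>, because \<open>Z \<ge> t C\<close> by \<open>prod_diff_ge_sum_diff\<close> and the maximality of \<open>\<beta>\<close>. The
  hypothesis \<open>Z \<le> \<alpha> (B - C)\<close> finishes. If \<open>a\<^sub>j\<close> is chosen maximal where
  \<open>a < b\<close>, just as \<open>b\<^sub>i\<close> is where \<open>b < a\<close>, then the lemma applies to \<open>a, b\<close> or to \<open>b, a\<close>.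
\<close>

lemma prod_pair_ge_notched:
  fixes a b :: "'a \<Rightarrow> int"
  assumes fin: "finite I" and pos: "\<And>l. l \<in> I \<Longrightarrow> 1 \<le> a l \<and> 1 \<le> b l"
    and eq: "sum a I = sum b I" and ij: "i \<in> I" "j \<in> I" "b i < a i" "a j < b j"
    and maxi: "\<And>l. l \<in> I \<Longrightarrow> b l < a l \<Longrightarrow> b l \<le> b i"
    and C: "C = (\<Prod>l\<in>I. min (a l) (b l))"
    and le: "b i * (prod a I - C) \<le> a j * (prod b I - C)"
    and u: "u = a(j := a j + 1)"
  shows "prod u I - prod u (I - {i, j}) \<le> prod a I + prod b I - C"
proof -
  define A B W \<alpha> \<beta> p t Z where "A = prod a I" and "B = prod b I" and "W = prod a (I - {i, j})"
    and "\<alpha> = a j" and "\<beta> = b i" and "p = a i" and "t = (\<Sum>l\<in>I. a l - min (a l) (b l))"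
    and "Z = \<beta> * (A - C)"
  have ne: "i \<noteq> j" using ij by auto
  have \<alpha>: "1 \<le> \<alpha>" and \<beta>: "1 \<le> \<beta>" using pos ij by (auto simp: \<alpha>_def \<beta>_def)
  have Cpos: "0 < C" unfolding C using pos by (intro prod_pos) force
  have Wpos: "0 < W" unfolding W_def using pos by (intro prod_pos) force
  have tZ: "t * C \<le> Z" unfolding t_def C Z_def A_def
  proof (intro prod_diff_ge_sum_diff)
    show "0 \<le> \<beta>" using \<beta> by simp
  qed (use fin pos maxi in \<open>auto simp: \<beta>_def min_def\<close>)
  have pt: "p \<le> \<beta> + t"
  proof -
    have "a i - min (a i) (b i) \<le> t" unfolding t_def
      using ij fin by (intro member_le_sum) auto
    then show ?thesis using ij by (simp add: p_def \<beta>_def)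
  qed
  have t1: "1 \<le> t" 
  proof -
    have "a i - min (a i) (b i) \<le> t" unfolding t_def
      using ij fin by (intro member_le_sum) auto
    then show ?thesis using ij by simp
  qed
  have A: "A = p * \<alpha> * W"
    using prod_remove_marks[OF fin ij(1,2) ne, of a] by (simp add: A_def W_def \<alpha>_def p_def)
  have Wu: "prod u (I - {i, j}) = W" unfolding W_def u by (intro prod.cong) auto
  have U: "prod u I = p * (\<alpha> + 1) * W"
    using prod_remove_marks[OF fin ij(1,2) ne, of u] Wu ne by (simp add: u \<alpha>_def p_def)
  have "\<beta> * C * (\<beta> + t - 1) \<le> Z * ((\<beta> - 1) * (\<beta> + t) + 1)"
  proof -
    have "0 \<le> (t - 1) * ((\<beta> - 1) * (\<beta> + t)) * C" using t1 \<beta> Cpos by simp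
    then have "\<beta> * C * (\<beta> + t - 1) \<le> t * C * ((\<beta> - 1) * (\<beta> + t) + 1)"
      by (simp add: algebra_simps)
    also have "\<dots> \<le> Z * ((\<beta> - 1) * (\<beta> + t) + 1)"
      using tZ \<beta> t1 by (intro mult_right_mono) auto
    finally show ?thesis .
  qed
  then have "\<beta> * ((\<beta> + t - 1) * A) \<le> \<beta> * ((\<beta> + t) * Z)"
    by (simp add: Z_def algebra_simps)
  then have "(\<beta> + t - 1) * A \<le> (\<beta> + t) * Z" using \<beta> by simp
  moreover have "(\<beta> + t) * ((p - 1) * (\<alpha> * W)) \<le> (\<beta> + t - 1) * A"
    using mult_right_mono[OF pt, of "\<alpha> * W"] \<alpha> Wpos unfolding A by (simp add: algebra_simps)
  ultimately have "(\<beta> + t) * ((p - 1) * (\<alpha> * W)) \<le> (\<beta> + t) * Z" by linarith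
  then have "(p - 1) * (\<alpha> * W) \<le> Z" using \<beta> t1 by simp
  also have "Z \<le> \<alpha> * (B - C)" using le by (simp add: Z_def A_def B_def \<alpha>_def \<beta>_def)
  finally have "\<alpha> * ((p - 1) * W) \<le> \<alpha> * (B - C)" by (simp add: algebra_simps)
  then have "(p - 1) * W \<le> B - C" using \<alpha> by simp
  then show ?thesis unfolding Wu U A_def[symmetric] B_def[symmetric] A
    by (simp add: algebra_simps)
qed

theorem theorem8p5:
  fixes d :: int and m k :: nat and e a b :: "nat \<Rightarrow> int"
  assumes "d \<ge> 1"
    and "\<And>i. i \<in> {1..m} \<Longrightarrow> 1 \<le> e i"
    and "\<And>i j. 1 \<le> i \<Longrightarrow> i \<le> j \<Longrightarrow> j \<le> m \<Longrightarrow> e i \<le> e j"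
    and "\<And>i. i \<in> {1..m} \<Longrightarrow> 1 \<le> a i \<and> a i \<le> e i"
    and "\<And>i. i \<in> {1..m} \<Longrightarrow> 1 \<le> b i \<and> b i \<le> e i"
    and "d = (\<Sum>i=1..m. a i)" and "d = (\<Sum>i=1..m. b i)"
    and "\<exists>i\<in>{1..m}. a i \<noteq> b i"
    and "1 \<le> k" and "k < m"
  shows "seq_pi m a b \<ge>
           ((\<Sum>i=1..m. a i) - (\<Sum>i=k+1..m. e i) - (int k - 2)) * (\<Prod>i=k+1..m. e i)
           - (\<Prod>i=k+2..m. e i)"
proof -
  define I H C where "I = {1..m}" and "H = {k+1..m}"
    and "C = (\<Prod>l\<in>I. min (a l) (b l))"
  have fin: "finite I" by (simp add: I_def)
  obtain u i j where cap: "capped I H e u" and sum: "sum u I = sum a I + 1"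
    and ij: "i \<in> I" "j \<in> I" "i \<noteq> j" "2 \<le> u i" "2 \<le> u j"
    and u: "prod u I - prod u (I - {i, j}) \<le> prod a I + prod b I - C"
  proof -
    have eq: "sum a I = sum b I" using assms(6,7) by (simp add: I_def)
    have ex: "\<exists>i\<in>I. y i < x i" 
      if "sum x I = sum y I" "\<exists>i\<in>I. x i \<noteq> y i" for x y :: "nat \<Rightarrow> int"
    proof (rule ccontr)
      assume "\<not> ?thesis"
      then have "\<forall>i\<in>I. x i \<le> y i" by auto
      moreover from this that(2) have "\<exists>i\<in>I. x i < y i" by force
      ultimately have "sum x I < sum y I" using fin by (intro sum_strict_mono_ex1) auto
      then show False using that(1) by simp
    qed
    define Ia Ib where "Ia = {l \<in> I. b l < a l}" and "Ib = {l \<in> I. a l < b l}"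
    have diff: "\<exists>i\<in>I. a i \<noteq> b i" and diff': "\<exists>i\<in>I. b i \<noteq> a i"
      unfolding I_def using assms(8) by (metis, metis)
    have ne: "Ia \<noteq> {}" "Ib \<noteq> {}"
      using ex[OF eq diff] ex[OF eq[symmetric] diff'] by (auto simp: Ia_def Ib_def)
    have fins: "finite Ia" "finite Ib" using fin by (auto simp: Ia_def Ib_def)
    have argmax: "\<exists>x\<in>S. \<forall>l\<in>S. f l \<le> f x" if "finite S" "S \<noteq> {}" for S and f :: "nat \<Rightarrow> int"
    proof -
      have "Max (f ` S) \<in> f ` S" using that by (intro Max_in) auto
      then obtain x where "x \<in> S" "f x = Max (f ` S)" by auto
      then show ?thesis using that by (intro bexI[of _ x]) auto
    qed
    obtain i where i: "i \<in> Ia" "\<And>l. l \<in> Ia \<Longrightarrow> b l \<le> b i"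
      using argmax[OF fins(1) ne(1), of b] by blast
    obtain j where j: "j \<in> Ib" "\<And>l. l \<in> Ib \<Longrightarrow> a l \<le> a j"
      using argmax[OF fins(2) ne(2), of a] by blast
    have pos: "\<And>l. l \<in> I \<Longrightarrow> 1 \<le> a l \<and> 1 \<le> b l" using assms(4,5) by (auto simp: I_def)
    have ub: "\<And>l. l \<in> I \<Longrightarrow> a l \<le> e l \<and> b l \<le> e l" using assms(4,5) by (auto simp: I_def)
    have low: "\<And>l h. l \<in> I - H \<Longrightarrow> h \<in> H \<Longrightarrow> e l \<le> e h" and HI: "H \<subseteq> I"
      using assms(3) by (auto simp: I_def H_def)
    have sum_upd: "sum (x(l := x l + 1)) I = sum x I + 1" if "l \<in> I" for x :: "nat \<Rightarrow> int" and l
    proof -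
      have "sum (x(l := x l + 1)) (I - {l}) = sum x (I - {l})" by (intro sum.cong) auto
      then show ?thesis
        using sum.remove[OF fin that, of x] sum.remove[OF fin that, of "x(l := x l + 1)"] by simp
    qed
    have ijI: "i \<in> I" "j \<in> I" "i \<noteq> j" "b i < a i" "a j < b j"
      using i(1) j(1) by (auto simp: Ia_def Ib_def)
    have room: "0 \<le> a j" "a j + 1 \<le> e j" "0 \<le> b i" "b i + 1 \<le> e i"
      using ub[OF ijI(1)] ub[OF ijI(2)] pos[OF ijI(1)] pos[OF ijI(2)] ijI(4,5) by linarith+
    show thesis
    proof (cases "b i * (prod a I - C) \<le> a j * (prod b I - C)")
      case True
      define u where "u = a(j := a j + 1)"
      have "prod u I - prod u (I - {i, j}) \<le> prod a I + prod b I - C"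
        using True i(2) ijI
        by (intro prod_pair_ge_notched[OF fin pos eq _ _ _ _ _ C_def _ u_def]) (auto simp: Ia_def)
      moreover have "capped I H e u"
        using fin HI low pos ub room ijI
        by (auto simp: capped_def u_def)
      moreover have "2 \<le> u i" "2 \<le> u j" using pos[of i] pos[of j] ijI by (auto simp: u_def)
      ultimately show ?thesis using that[of u i j] ijI sum_upd[of j a] by (simp add: u_def)
    next
      case False
      define u where "u = b(i := b i + 1)"
      have C': "C = (\<Prod>l\<in>I. min (b l) (a l))" by (simp add: C_def min.commute)
      have "prod u I - prod u (I - {j, i}) \<le> prod b I + prod a I - C"
        using False j(2) ijI pos
        by (intro prod_pair_ge_notched[OF fin _ eq[symmetric] _ _ _ _ _ C' _ u_def]) (auto simp: Ib_def)
      moreover have "capped I H e u"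
        using fin HI low pos ub room ijI
        by (auto simp: capped_def u_def)
      moreover have "2 \<le> u i" "2 \<le> u j" using pos[of i] pos[of j] ijI by (auto simp: u_def)
      ultimately show ?thesis using that[of u j i] ijI eq sum_upd[of i b]
        by (simp add: u_def add.commute)
    qed
  qed
  define s E' r where "s = e (k + 1)" and "E' = prod e {k+2..m}" and "r = excess I H e u"
  have s: "1 \<le> s" "\<And>h. h \<in> H \<Longrightarrow> s \<le> e h"
    using assms(2,3,9,10) by (auto simp: s_def H_def)
  have "H = insert (k + 1) {k+2..m}" using assms(10) by (auto simp: H_def)
  then have E: "prod e H = s * E'" by (simp add: s_def E'_def)
  have "I - H = {1..k}" using assms(10) by (auto simp: I_def H_def)
  then have r: "r = sum a I - sum e H - (int k - 2)"
    by (simp add: r_def excess_def sum)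
  have "s * (r * prod e H) \<le> s * (prod u I - prod u (I - {i, j})) + s * E'"
    using notched_bound[OF cap ij s] by (simp add: notched_bound_def r_def E)
  then have "s * (r * prod e H) \<le> s * ((prod u I - prod u (I - {i, j})) + E')"
    by (simp add: algebra_simps)
  then have "r * prod e H \<le> (prod u I - prod u (I - {i, j})) + E'"
    using s(1) by (simp add: mult_le_cancel_left)
  with u show ?thesis
    unfolding seq_pi_def r I_def H_def C_def E'_def by simp
qed

end
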